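(* Let $\mathcal{X}\subset\mathbb{R}^d$ be a closed convex set, let $r$ be the indicator function of $\mathcal{X}$ ($r=0$ on $\mathcal{X}$ and $r=+\infty$ off $\mathcal{X}$), let $g:\mathbb{R}^d\to\mathbb{R}$ be $\rho$-weakly convex, and set $\varphi:=g+r$. Assume (A1), (A2), (A3) stated in the context. Let $x_0\in\mathcal{X}$, let $T\ge 0$ be an integer, let $\{\alpha_t\}_{t\ge 0}$ be positive reals, and let $x_{t^*}$ be the (random) point returned by the stochastic projected subgradient method described in the context. Then for every constant $\hat\rho>\rho$, $$\mathbb{E}\left[\|\nabla\varphi_{1/\hat\rho}(x_{t^*})\|^2\right]\le \frac{\hat\rho}{\hat\rho-\rho}\cdot\frac{\left(\varphi_{1/\hat\rho}(x_0)-\min\varphi\right)+\frac{\hat\rho L^2}{2}\sum_{t=0}^T\alpha_t^2}{\sum_{t=0}^T\alpha_t}.$$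
   Context: Norms are Euclidean. For a real $\rho\ge 0$, a function $g:\mathbb{R}^d\to\mathbb{R}$ is $\rho$-weakly convex if $x\mapsto g(x)+\frac{\rho}{2}\|x\|^2$ is convex. The subdifferential $\partial g(x)$ is the set of all $v\in\mathbb{R}^d$ with $g(y)\ge g(x)+\langle v,y-x\rangle+o(\|y-x\|)$ as $y\to x$. For $\lambda>0$ the Moreau envelope is $\varphi_\lambda(x):=\min_y\{\varphi(y)+\frac{1}{2\lambda}\|y-x\|^2\}$; for $\lambda<\rho^{-1}$ (any $\lambda>0$ if $\rho=0$) it is $C^1$ with $\nabla\varphi_\lambda(x)=\lambda^{-1}(x-\mathrm{prox}_{\lambda\varphi}(x))$, where $\mathrm{prox}_{\lambda\varphi}(x)$ is the unique minimizer. $\min\varphi$ denotes the minimum value of $\varphi$, assumed to exist. Stochastic oracle: fix a probability space $(\Omega,\mathcal{F},P)$ and equip $\mathbb{R}^d$ with the Borel $\sigma$-algebra. Assumptions: (A1) It is possible to generate i.i.d. realizations $\xi_0,\xi_1,\ldots\sim P$. (A2) There is an open set $U$ containing $\mathrm{dom}\, r=\mathcal{X}$ and a measurable mapping $G:U\times\Omega\to\mathbb{R}^d$ with $\mathbb{E}_\xi[G(x,\xi)]\in\partial g(x)$ for all $x\in U$. (A3) There is a real $L\ge 0$ such that $\mathbb{E}_\xi[\|G(x,\xi)\|^2]\le L^2$ for all $x\in\mathrm{dom}\, r$. Stochastic projected subgradient method: given $x_0\in\mathcal{X}$, for $t=0,\ldots,T$ sample $\xi_t\sim P$ (independently) and set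 $x_{t+1}=\mathrm{proj}_{\mathcal{X}}(x_t-\alpha_tG(x_t,\xi_t))$, where $\mathrm{proj}_{\mathcal{X}}$ is the nearest-point projection. Then sample $t^*\in\{0,\ldots,T\}$, independently of the $\xi_t$, with $\mathbb{P}(t^*=t)=\alpha_t/\sum_{s=0}^T\alpha_s$, and return $x_{t^*}$. The expectation is over all this randomness. *)

theory Defs
  imports "HOL-Probability.Probability" "HOL-Library.Landau_Symbols"
begin

definition weakly_convex :: "real \<Rightarrow> ('a::real_inner \<Rightarrow> real) \<Rightarrow> bool" where
  "weakly_convex \<rho> g \<longleftrightarrow> convex_on UNIV (\<lambda>x. g x + \<rho> / 2 * (norm x)\<^sup>2)"

text \<open>The function \<open>h\<close> is the remainder term \<open>o(norm (y - x))\<close> as \<open>y \<rightarrow> x\<close>.\<close>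

definition subdifferential :: "('a::real_inner \<Rightarrow> real) \<Rightarrow> 'a \<Rightarrow> 'a set" where
  "subdifferential g x =
     {v. \<exists>h :: 'a \<Rightarrow> real. h \<in> o[at x](\<lambda>y. norm (y - x)) \<and>
         (\<forall>\<^sub>F y in at x. g y \<ge> g x + v \<bullet> (y - x) + h y)}"

definition indicator_fun :: "'a set \<Rightarrow> 'a \<Rightarrow> ereal" where
  "indicator_fun X x = (if x \<in> X then 0 else \<infinity>)"

definition eff_dom :: "('a \<Rightarrow> ereal) \<Rightarrow> 'a set" where
  "eff_dom f = {x. f x < \<infinity>}"

text \<open>The attained minimum of an extended-valued function (not merely its infimum); unspecified
  if the minimum is not attained. It is converted to a real number, so it is meaningful only
  when the minimum is attained and finite.\<close>

definition min_value :: "('a \<Rightarrow> ereal) \<Rightarrow> real" where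
  "min_value f = real_of_ereal (LEAST m. m \<in> range f)"

definition moreau_envelope :: "real \<Rightarrow> ('a::real_inner \<Rightarrow> ereal) \<Rightarrow> 'a \<Rightarrow> real" where
  "moreau_envelope l f x = min_value (\<lambda>y. f y + ereal (1 / (2 * l) * (norm (y - x))\<^sup>2))"

definition gradient :: "('a::real_inner \<Rightarrow> real) \<Rightarrow> 'a \<Rightarrow> 'a" where
  "gradient f x = (THE D. GDERIV f x :> D)"

text \<open>Independence of two random variables with values in spaces of different types; the library's
  \<open>indep_var\<close> requires both to have the same type.\<close>

definition indep_rv ::
  "'m measure \<Rightarrow> 'b measure \<Rightarrow> ('m \<Rightarrow> 'b) \<Rightarrow> 'c measure \<Rightarrow> ('m \<Rightarrow> 'c) \<Rightarrow> bool" where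
  "indep_rv M S X N Y \<longleftrightarrow> X \<in> measurable M S \<and> Y \<in> measurable M N \<and>
     prob_space.indep_set M {X -` A \<inter> space M | A. A \<in> sets S} {Y -` B \<inter> space M | B. B \<in> sets N}"

text \<open>Iterates of the projected subgradient method along one realization
  \<open>w 0, w 1, \<dots>\<close> of the samples, with step sizes \<open>a\<close>.\<close>

primrec psg_iterate ::
  "'a::euclidean_space set \<Rightarrow> ('a \<Rightarrow> 'w \<Rightarrow> 'a) \<Rightarrow> (nat \<Rightarrow> real) \<Rightarrow> 'a \<Rightarrow> (nat \<Rightarrow> 'w) \<Rightarrow> nat \<Rightarrow> 'a"
where
  "psg_iterate X G a x0 w 0 = x0"
| "psg_iterate X G a x0 w (Suc t) =
     closest_point X (psg_iterate X G a x0 w t - a t *\<^sub>R G (psg_iterate X G a x0 w t) (w t))"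

end

theory Submission
  imports Defs
begin

text \<open>
  Write \<open>\<phi> = g + r\<close> and \<open>s\<close> for the constant called \<open>\<rho>hat\<close> in the theorem. The Moreau envelope
  \<open>\<phi>\<^bsub>1/s\<^esub>\<close> is used as a Lyapunov function: although \<open>\<phi>\<close> need not decrease along the
  method, even in expectation, its envelope does, up to a term of order \<open>\<alpha>\<^sub>t\<^sup>2\<close>.

  Let \<open>x\<close> be the current iterate, \<open>a\<close> the step size, \<open>p = prox x\<close>, and \<open>d\<close> the sampled direction with mean \<open>v\<close> in the
  subdifferential of \<open>g\<close> at \<open>x\<close>. The point \<open>p\<close> is feasible, so it is a competitor in the minimum that
  defines the envelope at the next iterate, and projecting onto \<open>X\<close> does not increase the distance to
  \<open>p\<close>. Expanding the square gives
  \<open>\<phi>\<^bsub>1/s\<^esub>(x') \<le> \<phi>\<^bsub>1/s\<^esub>(x) + s a \<langle>d, p - x\<rangle> + s a\<^sup>2/2 \<parallel>d\<parallel>\<^sup>2\<close> for the next iterate \<open>x'\<close>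
  (\<open>envelope_projected_step\<close>). In the mean, \<open>d\<close> becomes \<open>v\<close>, and two convexity facts bound the inner
  product. The subgradient inequality of a weakly convex function gives
  \<open>\<langle>v, p - x\<rangle> \<le> g(p) - g(x) + \<rho>/2 \<parallel>p - x\<parallel>\<^sup>2\<close>. The function \<open>y \<mapsto> g(y) + s/2 \<parallel>y - x\<parallel>\<^sup>2\<close>
  is strongly convex with constant \<open>s - \<rho>\<close> and minimal at \<open>p\<close>, so its value \<open>g(x)\<close> at \<open>x\<close> exceeds the
  minimum by at least \<open>(s - \<rho>)/2 \<parallel>p - x\<parallel>\<^sup>2\<close>. Together,
  \<open>\<langle>v, p - x\<rangle> \<le> -(s - \<rho>) \<parallel>p - x\<parallel>\<^sup>2\<close> (\<open>subgradient_prox_decrease\<close>). Since the gradient of the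
  envelope at \<open>x\<close> is \<open>s (x - p)\<close>, the expected decrease is \<open>a (s - \<rho>)/s\<close> times the squared norm of this
  gradient, up to the error \<open>s a\<^sup>2 L\<^sup>2/2\<close> (\<open>expected_envelope_step\<close>).

  Iterate \<open>t\<close> depends only on the samples before time \<open>t\<close>, so the one-step bounds can be integrated
  against the product of the sample laws and telescoped (\<open>expected_psg_descent\<close>). The envelope is at
  least \<open>min \<phi>\<close>; what remains is a bound on the sum of the expected squared gradients weighted by
  \<open>\<alpha>\<^sub>t\<close>. Because \<open>t\<^sup>*\<close> is independent of the samples and has law proportional to \<open>\<alpha>\<close>, that sum, divided
  by the total step size, is the expectation at the returned point.

  Integrability is obtained on the way: all expectations are taken as integrals of nonnegative functions
  in \<open>[0, \<infinity>]\<close>, and the final bound is finite.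
\<close>

section \<open>Weakly convex functions\<close>

lemma norm_add_power2:
  fixes a b :: "'a::real_inner"
  shows "(norm (a + b))\<^sup>2 = (norm a)\<^sup>2 + 2 * (a \<bullet> b) + (norm b)\<^sup>2"
  by (simp add: power2_norm_eq_inner inner_add_left inner_add_right inner_commute)

lemma norm_diff_segment:
  fixes p y x :: "'a::real_inner"
  shows "(norm (p + t *\<^sub>R (y - p) - x))\<^sup>2 =
         (1 - t) * (norm (p - x))\<^sup>2 + t * (norm (y - x))\<^sup>2 - t * (1 - t) * (norm (y - p))\<^sup>2"
proof -
  have "(norm (y - x))\<^sup>2 = (norm (p - x))\<^sup>2 + 2 * ((p - x) \<bullet> (y - p)) + (norm (y - p))\<^sup>2"
    using norm_add_power2[of "p - x" "y - p"] by simp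
  moreover have "(norm (p + t *\<^sub>R (y - p) - x))\<^sup>2 =
      (norm (p - x))\<^sup>2 + 2 * t * ((p - x) \<bullet> (y - p)) + t * t * (norm (y - p))\<^sup>2"
    using norm_add_power2[of "p - x" "t *\<^sub>R (y - p)"]
    by (simp add: power_mult_distrib power2_eq_square diff_add_eq)
  ultimately show ?thesis by (simp only:) (simp add: field_simps)
qed

text \<open>
  By \<open>norm_diff_segment\<close>, the squared norm falls short of its chord by exactly
  \<open>t (1 - t) \<parallel>y - p\<parallel>\<^sup>2\<close>; subtracting it from the convex function in the definition leaves this defect.
\<close>

lemma weakly_convex_segment:
  assumes "weakly_convex \<rho> g" and "0 \<le> t" and "t \<le> 1"
  shows "g (p + t *\<^sub>R (y - p)) \<le>
         (1 - t) * g p + t * g y + \<rho> / 2 * (t * (1 - t) * (norm (y - p))\<^sup>2)"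
proof -
  have "g ((1 - t) *\<^sub>R p + t *\<^sub>R y) + \<rho> / 2 * (norm ((1 - t) *\<^sub>R p + t *\<^sub>R y))\<^sup>2
      \<le> (1 - t) * (g p + \<rho> / 2 * (norm p)\<^sup>2) + t * (g y + \<rho> / 2 * (norm y)\<^sup>2)"
    using convex_onD[OF assms(1)[unfolded weakly_convex_def] assms(2,3)] by simp
  moreover have "(1 - t) *\<^sub>R p + t *\<^sub>R y = p + t *\<^sub>R (y - p)"
    by (simp add: algebra_simps)
  moreover have "(norm (p + t *\<^sub>R (y - p)))\<^sup>2 =
      (1 - t) * (norm p)\<^sup>2 + t * (norm y)\<^sup>2 - t * (1 - t) * (norm (y - p))\<^sup>2"
    using norm_diff_segment[of p t y 0] by simp
  ultimately have "g (p + t *\<^sub>R (y - p)) \<le>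
      (1 - t) * (g p + \<rho> / 2 * (norm p)\<^sup>2) + t * (g y + \<rho> / 2 * (norm y)\<^sup>2)
      - \<rho> / 2 * ((1 - t) * (norm p)\<^sup>2 + t * (norm y)\<^sup>2 - t * (1 - t) * (norm (y - p))\<^sup>2)"
    by simp
  also have "\<dots> = (1 - t) * g p + t * g y + \<rho> / 2 * (t * (1 - t) * (norm (y - p))\<^sup>2)"
    by (simp add: field_simps)
  finally show ?thesis .
qed

lemma weakly_convex_continuous:
  fixes g :: "'a::euclidean_space \<Rightarrow> real"
  assumes "weakly_convex \<rho> g"
  shows "continuous_on UNIV g"
proof -
  have "continuous_on UNIV (\<lambda>x. g x + \<rho> / 2 * (norm x)\<^sup>2)"
    using assms unfolding weakly_convex_def by (intro convex_on_continuous) auto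
  moreover have "continuous_on UNIV (\<lambda>x::'a. \<rho> / 2 * (norm x)\<^sup>2)"
    by (intro continuous_intros)
  ultimately have "continuous_on UNIV (\<lambda>x. g x + \<rho> / 2 * (norm x)\<^sup>2 - \<rho> / 2 * (norm x)\<^sup>2)"
    by (rule continuous_on_diff)
  then show ?thesis by simp
qed

text \<open>
  The local inequality that defines a subgradient becomes a global one: it is applied at
  \<open>x + t (y - x)\<close> for a small \<open>t\<close>, compared there with the chord inequality, and divided by \<open>t\<close>; the
  little-o remainder then contributes an arbitrarily small multiple of \<open>\<parallel>y - x\<parallel>\<close>.
\<close>

lemma weakly_convex_subgradient:
  assumes wc: "weakly_convex \<rho> g" and "\<rho> \<ge> 0" and v: "v \<in> subdifferential g x"
  shows "v \<bullet> (y - x) \<le> g y - g x + \<rho> / 2 * (norm (y - x))\<^sup>2"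
proof (cases "y = x")
  case False
  then have n: "norm (y - x) > 0" by simp
  obtain h where h: "h \<in> o[at x](\<lambda>y. norm (y - x))"
      and ev: "\<forall>\<^sub>F z in at x. g z \<ge> g x + v \<bullet> (z - x) + h z"
    using v unfolding subdifferential_def by auto
  show ?thesis
  proof (rule field_le_epsilon)
    fix e :: real assume "e > 0"
    define c where "c = e / norm (y - x)"
    have "c > 0" using \<open>e > 0\<close> n by (simp add: c_def)
    have "\<forall>\<^sub>F z in at x. g z \<ge> g x + v \<bullet> (z - x) - c * norm (z - x)"
      using ev landau_o.smallD[OF h \<open>c > 0\<close>] by eventually_elim auto
    then obtain d where d: "d > 0"
        "\<And>z. z \<noteq> x \<Longrightarrow> dist z x < d \<Longrightarrow> g z \<ge> g x + v \<bullet> (z - x) - c * norm (z - x)"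
      unfolding eventually_at by auto
    \<comment> \<open>The point at parameter \<open>t\<close> lies within half the radius \<open>d\<close> of \<open>x\<close>.\<close>
    define t where "t = min 1 (d / (2 * norm (y - x)))"
    have t: "0 < t" "t \<le> 1" using d n by (auto simp: t_def)
    have "t * norm (y - x) \<le> d / (2 * norm (y - x)) * norm (y - x)"
      by (intro mult_right_mono) (auto simp: t_def)
    also have "\<dots> < d" using d n by simp
    finally have td: "t * norm (y - x) < d" .
    have "g (x + t *\<^sub>R (y - x)) \<ge> g x + t * (v \<bullet> (y - x)) - c * (t * norm (y - x))"
      using d(2)[of "x + t *\<^sub>R (y - x)"] t td False by (simp add: dist_norm)
    with weakly_convex_segment[OF wc, of t x y] t
    have "t * (v \<bullet> (y - x)) \<le>
        t * (g y - g x + \<rho> / 2 * ((1 - t) * (norm (y - x))\<^sup>2) + c * norm (y - x))"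
      by (simp add: algebra_simps)
    then have "v \<bullet> (y - x) \<le> g y - g x + \<rho> / 2 * ((1 - t) * (norm (y - x))\<^sup>2) + c * norm (y - x)"
      using t by simp
    moreover have "(1 - t) * (norm (y - x))\<^sup>2 \<le> 1 * (norm (y - x))\<^sup>2"
      using t by (intro mult_right_mono) auto
    then have "\<rho> / 2 * ((1 - t) * (norm (y - x))\<^sup>2) \<le> \<rho> / 2 * (norm (y - x))\<^sup>2"
      using \<open>\<rho> \<ge> 0\<close> by (intro mult_left_mono) auto
    moreover have "c * norm (y - x) = e" using n by (simp add: c_def)
    ultimately show "v \<bullet> (y - x) \<le> g y - g x + \<rho> / 2 * (norm (y - x))\<^sup>2 + e" by linarith
  qed
qed simp

lemma min_value_eqI:
  assumes "\<And>y. f x \<le> f y"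
  shows "min_value f = real_of_ereal (f x)"
proof -
  have "(LEAST m. m \<in> range f) = f x"
    using assms by (intro Least_equality) auto
  then show ?thesis by (simp add: min_value_def)
qed

lemma gradient_eqI:
  assumes "GDERIV f x :> D"
  shows "gradient f x = D"
  unfolding gradient_def
proof (rule the_equality)
  show "GDERIV f x :> D" by (rule assms)
next
  fix D' assume "GDERIV f x :> D'"
  then have "(\<lambda>h. h \<bullet> D') = (\<lambda>h. h \<bullet> D)"
    using assms unfolding gderiv_def by (rule has_derivative_unique)
  then have "(D' - D) \<bullet> D' = (D' - D) \<bullet> D" by metis
  then have "(D' - D) \<bullet> (D' - D) = 0" by (simp add: inner_diff_right)
  then show "D' = D" by simp
qed

section \<open>The proximal map and the Moreau envelope\<close>

text \<open>
  The objective is \<open>g\<close> restricted to \<open>X\<close>, kept real-valued; \<open>moreau_envelope_eq\<close> returns to the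
  extended-valued sum. The lower bound \<open>m\<close> makes the penalized objective coercive and is the
  value against which the envelope is telescoped.
\<close>

locale constrained_weakly_convex =
  fixes X :: "'a::euclidean_space set" and g :: "'a \<Rightarrow> real" and \<rho> s m :: real
  assumes X_closed: "closed X" and X_convex: "convex X" and X_nonempty: "X \<noteq> {}"
    and wc: "weakly_convex \<rho> g" and rho_nonneg: "\<rho> \<ge> 0" and rho_less: "\<rho> < s"
    and lower_bound: "\<And>y. y \<in> X \<Longrightarrow> m \<le> g y"
begin

definition penalized :: "'a \<Rightarrow> 'a \<Rightarrow> real" where
  "penalized x y = g y + s / 2 * (norm (y - x))\<^sup>2"

definition prox :: "'a \<Rightarrow> 'a" where
  "prox x = (SOME p. p \<in> X \<and> (\<forall>y\<in>X. penalized x p \<le> penalized x y))"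

definition envelope :: "'a \<Rightarrow> real" where
  "envelope x = penalized x (prox x)"

lemma s_pos: "s > 0"
  using rho_nonneg rho_less by simp

text \<open>
  Outside a large ball around \<open>x\<close> the quadratic alone outweighs \<open>g z - m\<close> for a fixed feasible \<open>z\<close>, so it
  suffices to minimize over the compact part of \<open>X\<close> inside the ball.
\<close>

lemma penalized_minimizer_exists: "\<exists>p\<in>X. \<forall>y\<in>X. penalized x p \<le> penalized x y"
proof -
  obtain z where "z \<in> X" using X_nonempty by auto
  define R where "R = norm (z - x) + sqrt (2 / s * (g z - m)) + 1"
  have gm: "2 / s * (g z - m) \<ge> 0"
    using lower_bound[OF \<open>z \<in> X\<close>] s_pos by simp
  have zR: "z \<in> X \<inter> cball x R"
    using \<open>z \<in> X\<close> gm by (simp add: R_def dist_norm norm_minus_commute add_nonneg_nonneg)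
  have "continuous_on UNIV (penalized x)"
    unfolding penalized_def by (intro continuous_intros weakly_convex_continuous[OF wc])
  then have "continuous_on (X \<inter> cball x R) (penalized x)"
    by (rule continuous_on_subset) simp
  moreover have "compact (X \<inter> cball x R)"
    using X_closed by (simp add: closed_Int_compact)
  ultimately obtain p where p: "p \<in> X \<inter> cball x R"
      "\<And>y. y \<in> X \<inter> cball x R \<Longrightarrow> penalized x p \<le> penalized x y"
    using continuous_attains_inf[of "X \<inter> cball x R" "penalized x"] zR by blast
  have "penalized x p \<le> penalized x y" if "y \<in> X" for y
  proof (cases "y \<in> cball x R")
    case False
    have "(norm (z - x))\<^sup>2 + 2 / s * (g z - m) = (norm (z - x))\<^sup>2 + (sqrt (2 / s * (g z - m)))\<^sup>2"
      using gm by simp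
    also have "\<dots> \<le> (norm (z - x) + sqrt (2 / s * (g z - m)))\<^sup>2"
      using gm by (simp add: power2_sum)
    also have "\<dots> \<le> (norm (y - x))\<^sup>2"
      using False gm by (intro power_mono) (auto simp: R_def dist_norm norm_minus_commute)
    finally have "s / 2 * ((norm (z - x))\<^sup>2 + 2 / s * (g z - m)) \<le> s / 2 * (norm (y - x))\<^sup>2"
      using s_pos by (intro mult_left_mono) auto
    moreover have "s / 2 * ((norm (z - x))\<^sup>2 + 2 / s * (g z - m))
        = s / 2 * (norm (z - x))\<^sup>2 + (g z - m)"
      using s_pos by (simp add: field_simps)
    ultimately have "penalized x z \<le> penalized x y"
      using lower_bound[OF that] by (simp add: penalized_def)
    with p(2)[OF zR] show ?thesis by simp
  qed (use p(2) that in auto)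
  with p(1) show ?thesis by auto
qed

lemma prox_in: "prox x \<in> X"
  and prox_le: "y \<in> X \<Longrightarrow> envelope x \<le> penalized x y"
proof -
  have "prox x \<in> X \<and> (\<forall>y\<in>X. penalized x (prox x) \<le> penalized x y)"
    unfolding prox_def using penalized_minimizer_exists[of x] unfolding Bex_def by (rule someI_ex)
  then show "prox x \<in> X" "y \<in> X \<Longrightarrow> envelope x \<le> penalized x y"
    by (auto simp: envelope_def)
qed

lemma envelope_lower_bound: "m \<le> envelope x"
  using lower_bound[OF prox_in[of x]] s_pos by (simp add: envelope_def penalized_def add_increasing2)

text \<open>
  The penalized objective is strongly convex with constant \<open>s - \<rho>\<close>. Comparing its minimum with its
  value at \<open>prox x + t (y - prox x)\<close> and dividing by \<open>t\<close> gives the claim with the factor \<open>1 - t\<close> on the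
  quadratic term, and \<open>t\<close> can be arbitrarily small.
\<close>

lemma quadratic_growth:
  assumes "y \<in> X"
  shows "envelope x + (s - \<rho>) / 2 * (norm (y - prox x))\<^sup>2 \<le> penalized x y"
proof (rule field_le_epsilon)
  fix e :: real assume "e > 0"
  define p where "p = prox x"
  define N where "N = (s - \<rho>) / 2 * (norm (y - p))\<^sup>2"
  have "N \<ge> 0" using rho_less by (simp add: N_def)
  \<comment> \<open>Small enough that the lost part \<open>t * N\<close> of the quadratic term is at most \<open>e\<close>.\<close>
  define t where "t = min 1 (e / (N + 1))"
  have t: "0 < t" "t \<le> 1" using \<open>e > 0\<close> \<open>N \<ge> 0\<close> by (auto simp: t_def)
  have "t * N \<le> e / (N + 1) * N" using \<open>N \<ge> 0\<close> by (intro mult_right_mono) (auto simp: t_def)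
  also have "\<dots> \<le> e" using \<open>e > 0\<close> \<open>N \<ge> 0\<close> by (simp add: field_simps)
  finally have tN: "t * N \<le> e" .
  have "p + t *\<^sub>R (y - p) = (1 - t) *\<^sub>R p + t *\<^sub>R y" by (simp add: algebra_simps)
  then have "p + t *\<^sub>R (y - p) \<in> X"
    using convexD_alt[OF X_convex prox_in assms, of t x] t by (simp add: p_def)
  then have "envelope x \<le> g (p + t *\<^sub>R (y - p)) + s / 2 * (norm (p + t *\<^sub>R (y - p) - x))\<^sup>2"
    using prox_le by (simp add: penalized_def)
  with weakly_convex_segment[OF wc, of t p y] t
  have "t * (envelope x + (1 - t) * N) \<le> t * penalized x y"
    unfolding norm_diff_segment N_def envelope_def penalized_def p_def[symmetric]
    by (simp add: algebra_simps diff_divide_distrib)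
  then have "envelope x + (1 - t) * N \<le> penalized x y" using t by simp
  then show "envelope x + (s - \<rho>) / 2 * (norm (y - prox x))\<^sup>2 \<le> penalized x y + e"
    using tN unfolding N_def p_def left_diff_distrib by linarith
qed

text \<open>
  Moving the centre of the penalty from \<open>x\<close> to \<open>y\<close> changes the penalized objective by a term that does
  not involve \<open>g\<close>. Both the differentiability of the envelope and the descent step follow from this
  identity.
\<close>

lemma penalized_shift:
  "penalized y p = penalized x p + s * ((x - p) \<bullet> (y - x)) + s / 2 * (norm (y - x))\<^sup>2"
proof -
  have "(norm (p - y))\<^sup>2 = (norm (p - x))\<^sup>2 + 2 * ((x - p) \<bullet> (y - x)) + (norm (y - x))\<^sup>2"
    using norm_add_power2[of "x - p" "y - x"] by (simp add: norm_minus_commute)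
  then show ?thesis by (simp only: penalized_def) (simp add: field_simps)
qed

text \<open>
  Adding the quadratic growth inequalities at \<open>x\<close> and at \<open>y\<close>, each tested with the other's minimizer,
  cancels all values of \<open>g\<close>; the Cauchy-Schwarz inequality does the rest.
\<close>

lemma prox_lipschitz: "norm (prox y - prox x) \<le> s / (s - \<rho>) * norm (y - x)"
proof -
  define d where "d = norm (prox y - prox x)"
  have "(s - \<rho>) * d\<^sup>2 \<le> penalized x (prox y) - envelope x + (penalized y (prox x) - envelope y)"
    using quadratic_growth[OF prox_in, of x y] quadratic_growth[OF prox_in, of y x]
    by (simp add: d_def norm_minus_commute field_simps)
  also have "\<dots> = s * ((prox y - prox x) \<bullet> (y - x))"
  proof -
    have "(norm (prox y - x))\<^sup>2 - (norm (prox x - x))\<^sup>2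
        + ((norm (prox x - y))\<^sup>2 - (norm (prox y - y))\<^sup>2) = 2 * ((prox y - prox x) \<bullet> (y - x))"
      unfolding power2_norm_eq_inner
      by (simp add: inner_diff_left inner_diff_right inner_commute)
    from arg_cong[OF this, of "\<lambda>z. s / 2 * z"] show ?thesis
      by (simp add: envelope_def penalized_def field_simps)
  qed
  also have "\<dots> \<le> s * (d * norm (y - x))"
    unfolding d_def using s_pos by (intro mult_left_mono norm_cauchy_schwarz) auto
  finally have "d * ((s - \<rho>) * d) \<le> d * (s * norm (y - x))"
    by (simp add: power2_eq_square algebra_simps)
  then have "(s - \<rho>) * d \<le> s * norm (y - x)"
    using s_pos by (cases "d = 0") (auto simp: d_def)
  then show ?thesis
    using rho_less by (simp add: d_def field_simps)
qed

lemma continuous_prox: "continuous_on UNIV prox"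
proof (rule continuous_on_eq_continuous_at[OF open_UNIV, THEN iffD2], rule ballI)
  fix x :: 'a
  have "((\<lambda>y. s / (s - \<rho>) * norm (y - x)) \<longlongrightarrow> 0) (at x)"
    by (intro tendsto_mult_right_zero tendsto_norm_zero LIM_zero tendsto_ident_at)
  then have "((\<lambda>y. norm (prox y - prox x)) \<longlongrightarrow> 0) (at x)"
    by (rule tendsto_sandwich[rotated 2, OF tendsto_const])
       (intro always_eventually allI norm_ge_zero prox_lipschitz)+
  then show "continuous (at x) prox"
    unfolding continuous_at using LIM_zero_cancel tendsto_norm_zero_iff by blast
qed

text \<open>
  Testing the minimum at \<open>y\<close> with the minimizer at \<open>x\<close> gives an upper bound on
  \<open>envelope y - envelope x\<close> that is affine in \<open>y\<close> up to \<open>s/2 \<parallel>y - x\<parallel>\<^sup>2\<close>. Exchanging the roles of \<open>x\<close> and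
  \<open>y\<close> gives a lower bound with the slope taken at \<open>y\<close>, and the Lipschitz bound on \<open>prox\<close> replaces this
  slope by the one at \<open>x\<close> at a quadratic cost.
\<close>

lemma envelope_gderiv: "GDERIV envelope x :> s *\<^sub>R (x - prox x)"
proof -
  define K where "K = s * (s / (s - \<rho>)) + s / 2"
  have upper: "envelope y - envelope x \<le> s * ((x - prox x) \<bullet> (y - x)) + s / 2 * (norm (y - x))\<^sup>2"
    for x y
    using prox_le[OF prox_in, of y x] penalized_shift[of y "prox x" x]
    by (simp add: envelope_def)
  have bound: "\<bar>envelope y - envelope x - (y - x) \<bullet> (s *\<^sub>R (x - prox x))\<bar> \<le> K * norm (y - x) * norm (y - x)"
    for y
  proof -
    have "s * ((x - prox x) \<bullet> (y - x)) - (envelope y - envelope x)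
        \<le> s * ((x - prox x) \<bullet> (y - x)) - s * ((y - prox y) \<bullet> (y - x)) + s / 2 * (norm (y - x))\<^sup>2"
      using upper[where x = y and y = x] by (simp add: norm_minus_commute inner_diff_right algebra_simps)
    also have "\<dots> = s * ((prox y - prox x) \<bullet> (y - x)) - s / 2 * (norm (y - x))\<^sup>2"
    proof -
      have "(x - prox x) \<bullet> (y - x) - (y - prox y) \<bullet> (y - x) + (norm (y - x))\<^sup>2
          = (prox y - prox x) \<bullet> (y - x)"
        unfolding power2_norm_eq_inner
        by (simp add: inner_diff_left inner_diff_right inner_commute)
      from this[symmetric] show ?thesis by (simp only:) (simp add: field_simps)
    qed
    also have "\<dots> \<le> s * (norm (prox y - prox x) * norm (y - x)) + s / 2 * (norm (y - x))\<^sup>2"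
    proof -
      have "s * ((prox y - prox x) \<bullet> (y - x)) \<le> s * (norm (prox y - prox x) * norm (y - x))"
        using s_pos by (intro mult_left_mono norm_cauchy_schwarz) auto
      moreover have "0 \<le> s / 2 * (norm (y - x))\<^sup>2" using s_pos by simp
      ultimately show ?thesis by linarith
    qed
    also have "\<dots> \<le> s * ((s / (s - \<rho>) * norm (y - x)) * norm (y - x)) + s / 2 * (norm (y - x))\<^sup>2"
      using s_pos by (intro add_right_mono mult_left_mono mult_right_mono prox_lipschitz) auto
    also have "\<dots> = K * norm (y - x) * norm (y - x)"
      by (simp add: K_def power2_eq_square distrib_right mult.assoc)
    finally have 1: "s * ((x - prox x) \<bullet> (y - x)) - (envelope y - envelope x)
        \<le> K * norm (y - x) * norm (y - x)" .
    have "s / 2 * (norm (y - x))\<^sup>2 \<le> K * norm (y - x) * norm (y - x)"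
      unfolding power2_eq_square mult.assoc using s_pos rho_less
      by (intro mult_right_mono) (auto simp: K_def)
    with upper[of y x] have 2: "envelope y - envelope x - s * ((x - prox x) \<bullet> (y - x))
        \<le> K * norm (y - x) * norm (y - x)" by linarith
    show ?thesis using 1 2 by (simp add: inner_commute abs_le_iff)
  qed
  have "((\<lambda>y. K * norm (y - x)) \<longlongrightarrow> 0) (at x)"
    by (intro tendsto_mult_right_zero tendsto_norm_zero LIM_zero tendsto_ident_at)
  then show ?thesis
    unfolding gderiv_def
  proof (rule has_derivativeI_sandwich[of 1, rotated 3])
    fix y assume "y \<noteq> x"
    then show "norm (envelope y - envelope x - (y - x) \<bullet> (s *\<^sub>R (x - prox x))) / norm (y - x) \<le> K * norm (y - x)"
      using bound[of y] by (simp add: divide_le_eq)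
  qed (auto intro: bounded_linear_inner_left simp del: inner_scaleR_right)
qed

lemma continuous_envelope: "continuous_on UNIV envelope"
  using envelope_gderiv unfolding gderiv_def
  by (metis continuous_at_imp_continuous_on has_derivative_continuous)

lemma moreau_envelope_eq:
  "moreau_envelope (1 / s) (\<lambda>x. ereal (g x) + indicator_fun X x) = envelope"
proof
  fix x
  have "min_value (\<lambda>y. ereal (g y) + indicator_fun X y + ereal (1 / (2 * (1 / s)) * (norm (y - x))\<^sup>2))
      = real_of_ereal (ereal (g (prox x)) + indicator_fun X (prox x)
            + ereal (1 / (2 * (1 / s)) * (norm (prox x - x))\<^sup>2))"
    using prox_in[of x] prox_le[of _ x]
    by (intro min_value_eqI) (auto simp: indicator_fun_def envelope_def penalized_def)
  then show "moreau_envelope (1 / s) (\<lambda>x. ereal (g x) + indicator_fun X x) x = envelope x"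
    using prox_in[of x]
    by (simp add: moreau_envelope_def indicator_fun_def envelope_def penalized_def)
qed

lemma gradient_envelope: "gradient envelope x = s *\<^sub>R (x - prox x)"
  by (rule gradient_eqI) (rule envelope_gderiv)

text \<open>
  Every subgradient at a feasible \<open>x\<close> makes an obtuse angle with the direction towards \<open>prox x\<close>, with a
  quantitative margin. The subgradient inequality loses \<open>\<rho>/2 \<parallel>x - prox x\<parallel>\<^sup>2\<close>, and quadratic growth at
  \<open>y = x\<close> wins \<open>s/2\<close> and \<open>(s - \<rho>)/2\<close> of the same quantity.
\<close>

lemma subgradient_prox_decrease:
  assumes "x \<in> X" and "v \<in> subdifferential g x"
  shows "v \<bullet> (prox x - x) \<le> - (s - \<rho>) * (norm (x - prox x))\<^sup>2"
  using quadratic_growth[OF assms(1), of x]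
    weakly_convex_subgradient[OF wc rho_nonneg assms(2), of "prox x"]
  by (simp add: envelope_def penalized_def norm_minus_commute field_simps)

text \<open>
  The projection fixes the feasible point \<open>prox x\<close> and is nonexpansive, so it does not increase the
  penalized value of \<open>prox x\<close> centred at the unprojected point; the rest is \<open>penalized_shift\<close>.
\<close>

lemma envelope_projected_step:
  "envelope (closest_point X (x - a *\<^sub>R d))
    \<le> envelope x + s * a * (d \<bullet> (prox x - x)) + s * a\<^sup>2 / 2 * (norm d)\<^sup>2"
proof -
  define z where "z = x - a *\<^sub>R d"
  have "dist (closest_point X (prox x)) (closest_point X z) \<le> dist (prox x) z"
    by (rule closest_point_lipschitz[OF X_convex X_closed X_nonempty])
  then have "norm (prox x - closest_point X z) \<le> norm (prox x - z)"
    using closest_point_self[OF prox_in[of x]] by (simp add: dist_norm)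
  then have "s / 2 * (norm (prox x - closest_point X z))\<^sup>2 \<le> s / 2 * (norm (prox x - z))\<^sup>2"
    using s_pos by (intro mult_left_mono power_mono) auto
  then have "envelope (closest_point X z) \<le> penalized z (prox x)"
    using prox_le[OF prox_in, of "closest_point X z" x] by (simp add: penalized_def)
  also have "\<dots> = envelope x + s * a * (d \<bullet> (prox x - x)) + s * a\<^sup>2 / 2 * (norm d)\<^sup>2"
  proof -
    have "z - x = - a *\<^sub>R d" by (simp add: z_def)
    then have "(norm (z - x))\<^sup>2 = a\<^sup>2 * (norm d)\<^sup>2"
        and "(x - prox x) \<bullet> (z - x) = a * (d \<bullet> (prox x - x))"
      by (simp_all add: power_mult_distrib inner_diff_left inner_diff_right inner_commute
          right_diff_distrib)
    then show ?thesis
      unfolding penalized_shift[of z _ x] envelope_def by simp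
  qed
  finally show ?thesis by (simp add: z_def)
qed

text \<open>
  Both sides are shifted by \<open>m\<close> so that they are nonnegative; the real inequality between the means is
  carried over to \<open>ennreal\<close>, where the telescoping takes place and integrability of the iterates need not
  be tracked.
\<close>

lemma expected_envelope_step:
  assumes P: "prob_space P" and "x \<in> X" and "a > 0"
    and d: "integrable P d" "(LINT \<omega>|P. d \<omega>) \<in> subdifferential g x"
    and d2: "integrable P (\<lambda>\<omega>. (norm (d \<omega>))\<^sup>2)" "(LINT \<omega>|P. (norm (d \<omega>))\<^sup>2) \<le> B"
  shows "(\<integral>\<^sup>+\<omega>. ennreal (envelope (closest_point X (x - a *\<^sub>R d \<omega>)) - m) \<partial>P)
      + ennreal ((s - \<rho>) / s * a) * ennreal ((norm (gradient envelope x))\<^sup>2)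
      \<le> ennreal (envelope x - m) + ennreal (s * B / 2 * a\<^sup>2)"
proof -
  interpret prob_space P by (rule P)
  \<comment> \<open>An integrable majorant of the shifted envelope at the next point.\<close>
  define h where "h \<omega> = envelope x + s * a * (d \<omega> \<bullet> (prox x - x)) + s * a\<^sup>2 / 2 * (norm (d \<omega>))\<^sup>2 - m" for \<omega>
  have env_le: "envelope (closest_point X (x - a *\<^sub>R d \<omega>)) - m \<le> h \<omega>" for \<omega>
    using envelope_projected_step[of x a "d \<omega>"] by (simp add: h_def)
  have int_inner: "integrable P (\<lambda>\<omega>. d \<omega> \<bullet> (prox x - x))"
    using d(1) by simp
  have h_int: "integrable P h"
    unfolding h_def using int_inner d2(1) by simp
  have h_nonneg: "h \<omega> \<ge> 0" for \<omega>
    using env_le[of \<omega>] envelope_lower_bound[of "closest_point X (x - a *\<^sub>R d \<omega>)"] by linarith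
  have "B \<ge> 0" using d2(2) by (rule order_trans[rotated]) simp
  have grad: "(norm (gradient envelope x))\<^sup>2 = s\<^sup>2 * (norm (x - prox x))\<^sup>2"
    using s_pos by (simp add: gradient_envelope power_mult_distrib)
  have "(LINT \<omega>|P. h \<omega>) = envelope x + s * a * ((LINT \<omega>|P. d \<omega>) \<bullet> (prox x - x))
      + s * a\<^sup>2 / 2 * (LINT \<omega>|P. (norm (d \<omega>))\<^sup>2) - m"
    unfolding h_def using int_inner d2(1) d(1) by (simp add: prob_space)
  also have "\<dots> \<le> envelope x + s * a * (- (s - \<rho>) * (norm (x - prox x))\<^sup>2) + s * a\<^sup>2 / 2 * B - m"
    using \<open>a > 0\<close> s_pos d2(2) subgradient_prox_decrease[OF \<open>x \<in> X\<close> d(2)]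
    by (intro add_mono diff_mono mult_left_mono) auto
  also have "s * a * (- (s - \<rho>) * (norm (x - prox x))\<^sup>2)
      = - ((s - \<rho>) / s * a * (norm (gradient envelope x))\<^sup>2)"
    unfolding grad using s_pos by (simp add: power2_eq_square field_simps)
  finally have le: "(LINT \<omega>|P. h \<omega>) + (s - \<rho>) / s * a * (norm (gradient envelope x))\<^sup>2
      \<le> (envelope x - m) + s * B / 2 * a\<^sup>2"
    by (simp add: algebra_simps)
  have "(\<integral>\<^sup>+\<omega>. ennreal (envelope (closest_point X (x - a *\<^sub>R d \<omega>)) - m) \<partial>P) \<le> (\<integral>\<^sup>+\<omega>. ennreal (h \<omega>) \<partial>P)"
    by (intro nn_integral_mono ennreal_leI env_le)
  also have "\<dots> = ennreal (LINT \<omega>|P. h \<omega>)"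
    by (intro nn_integral_eq_integral h_int AE_I2 h_nonneg)
  finally have "(\<integral>\<^sup>+\<omega>. ennreal (envelope (closest_point X (x - a *\<^sub>R d \<omega>)) - m) \<partial>P)
      + ennreal ((s - \<rho>) / s * a) * ennreal ((norm (gradient envelope x))\<^sup>2)
      \<le> ennreal (LINT \<omega>|P. h \<omega>) + ennreal ((s - \<rho>) / s * a * (norm (gradient envelope x))\<^sup>2)"
    using s_pos rho_less \<open>a > 0\<close>
    by (subst ennreal_mult) (auto intro!: add_right_mono)
  also have "\<dots> = ennreal ((LINT \<omega>|P. h \<omega>) + (s - \<rho>) / s * a * (norm (gradient envelope x))\<^sup>2)"
    using s_pos rho_less \<open>a > 0\<close> h_nonneg by (intro ennreal_plus[symmetric]) (auto intro!: integral_nonneg_AE)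
  also have "\<dots> \<le> ennreal ((envelope x - m) + s * B / 2 * a\<^sup>2)"
    by (rule ennreal_leI[OF le])
  also have "\<dots> = ennreal (envelope x - m) + ennreal (s * B / 2 * a\<^sup>2)"
    using s_pos \<open>B \<ge> 0\<close> envelope_lower_bound[of x] by (intro ennreal_plus) auto
  finally show ?thesis .
qed

end

section \<open>Iterates as functions of the sample sequence\<close>

text \<open>The method is adapted: iterate \<open>t\<close> is determined by the samples before time \<open>t\<close>.\<close>

lemma psg_iterate_cong:
  "(\<And>i. i < t \<Longrightarrow> w i = w' i) \<Longrightarrow> psg_iterate X G a x0 w t = psg_iterate X G a x0 w' t"
  by (induction t) auto

lemma psg_iterate_in:
  assumes "closed X" and "x0 \<in> X"
  shows "psg_iterate X G a x0 w t \<in> X"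
proof (cases t)
  case (Suc n)
  have "X \<noteq> {}" using assms by auto
  with Suc show ?thesis by (simp add: closest_point_in_set[OF assms(1)])
qed (use assms in simp)

text \<open>
  The oracle \<open>G\<close> is jointly measurable only over \<open>U\<close>, so the current point has to be known to stay in
  \<open>X\<close>, inside \<open>U\<close>, before it can be substituted.
\<close>

lemma borel_measurable_psg_step:
  fixes G :: "'a::euclidean_space \<Rightarrow> 'w \<Rightarrow> 'a"
  assumes X: "closed X" "convex X" "X \<noteq> {}" and "X \<subseteq> U"
    and G: "(\<lambda>(x, \<omega>). G x \<omega>) \<in> borel_measurable (restrict_space borel U \<Otimes>\<^sub>M P)"
    and x: "x \<in> borel_measurable N" "\<And>w. w \<in> space N \<Longrightarrow> x w \<in> X"
    and \<omega>: "\<omega> \<in> measurable N P"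
  shows "(\<lambda>w. closest_point X (x w - a *\<^sub>R G (x w) (\<omega> w))) \<in> borel_measurable N"
proof -
  have "x \<in> measurable N (restrict_space borel U)"
    using x \<open>X \<subseteq> U\<close> by (intro measurable_restrict_space2) auto
  then have "(\<lambda>w. (x w, \<omega> w)) \<in> measurable N (restrict_space borel U \<Otimes>\<^sub>M P)"
    using \<omega> by (rule measurable_Pair)
  from measurable_compose[OF this G]
  have [measurable]: "(\<lambda>w. G (x w) (\<omega> w)) \<in> borel_measurable N" by simp
  have [measurable]: "closest_point X \<in> borel_measurable borel"
    by (intro borel_measurable_continuous_onI continuous_on_closest_point X)
  note x(1)[measurable]
  show ?thesis by measurable
qed

lemma borel_measurable_psg_iterate:
  fixes G :: "'a::euclidean_space \<Rightarrow> 'w \<Rightarrow> 'a"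
  assumes X: "closed X" "convex X" "x0 \<in> X" and "X \<subseteq> U"
    and G: "(\<lambda>(x, \<omega>). G x \<omega>) \<in> borel_measurable (restrict_space borel U \<Otimes>\<^sub>M P)"
  shows "{..<t} \<subseteq> I \<Longrightarrow> (\<lambda>w. psg_iterate X G a x0 w t) \<in> borel_measurable (\<Pi>\<^sub>M i\<in>I. P)"
proof (induction t)
  case (Suc t)
  have "(\<lambda>w. closest_point X (psg_iterate X G a x0 w t - a t *\<^sub>R G (psg_iterate X G a x0 w t) (w t)))
      \<in> borel_measurable (\<Pi>\<^sub>M i\<in>I. P)"
  proof (rule borel_measurable_psg_step[OF _ _ _ \<open>X \<subseteq> U\<close> G])
    show "(\<lambda>w. psg_iterate X G a x0 w t) \<in> borel_measurable (\<Pi>\<^sub>M i\<in>I. P)"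
      using Suc.prems by (intro Suc.IH) auto
    show "(\<lambda>w. w t) \<in> measurable (\<Pi>\<^sub>M i\<in>I. P) P"
      using Suc.prems by (intro measurable_component_singleton) auto
  qed (use X psg_iterate_in[OF X(1) X(3)] in auto)
  then show ?case by simp
qed simp

section \<open>Telescoping a descent inequality over independent samples\<close>

text \<open>
  A descent inequality for one fresh sample at a fixed feasible point, with Lyapunov function \<open>V\<close>,
  gain \<open>D\<close> and error \<open>C\<close>, sums up along the method. Each expectation is taken over exactly the samples
  that the iterate depends on, so the step from \<open>n\<close> to \<open>n + 1\<close> is Tonelli's theorem for one new
  coordinate: with the old coordinates fixed, iterate \<open>n\<close> is a constant.
\<close>

lemma expected_psg_descent:
  fixes G :: "'a::euclidean_space \<Rightarrow> 'w \<Rightarrow> 'a" and V D :: "'a \<Rightarrow> ennreal" and b C :: "nat \<Rightarrow> ennreal"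
  assumes X: "closed X" "convex X" "x0 \<in> X" and "X \<subseteq> U"
    and G: "(\<lambda>(x, \<omega>). G x \<omega>) \<in> borel_measurable (restrict_space borel U \<Otimes>\<^sub>M P)"
    and P: "prob_space P"
    and [measurable]: "V \<in> borel_measurable borel" "D \<in> borel_measurable borel"
    and step: "\<And>x t. x \<in> X \<Longrightarrow>
      (\<integral>\<^sup>+\<omega>. V (closest_point X (x - a t *\<^sub>R G x \<omega>)) \<partial>P) + b t * D x \<le> V x + C t"
  shows "(\<integral>\<^sup>+w. V (psg_iterate X G a x0 w n) \<partial>(\<Pi>\<^sub>M i\<in>{..<n}. P))
      + (\<Sum>t<n. b t * (\<integral>\<^sup>+w. D (psg_iterate X G a x0 w t) \<partial>(\<Pi>\<^sub>M i\<in>{..<t}. P)))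
      \<le> V x0 + (\<Sum>t<n. C t)"
proof (induction n)
  case 0
  interpret prob_space "\<Pi>\<^sub>M i\<in>{}. P" by (intro prob_space_PiM P)
  show ?case by (simp add: emeasure_space_1)
next
  case (Suc n)
  let ?x = "\<lambda>w t. psg_iterate X G a x0 w t"
  let ?Q = "\<lambda>n. \<Pi>\<^sub>M i\<in>{..<n}. P"
  let ?S = "\<lambda>x \<omega>. closest_point X (x - a n *\<^sub>R G x \<omega>)"
  interpret P: prob_space P by (rule P)
  interpret product_sigma_finite "\<lambda>_::nat. P" by unfold_locales
  interpret Qn: prob_space "?Q n" by (intro prob_space_PiM P)
  have x_meas [measurable]: "(\<lambda>w. ?x w t) \<in> borel_measurable (\<Pi>\<^sub>M i\<in>I. P)" if "{..<t} \<subseteq> I" for t I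
    by (rule borel_measurable_psg_iterate[OF X \<open>X \<subseteq> U\<close> G that])
  have [measurable]: "(\<lambda>w. ?x w n) \<in> borel_measurable (?Q n)" by (rule x_meas) simp
  have "(\<lambda>z. V (?S (?x (fst z) n) (snd z))) \<in> borel_measurable (?Q n \<Otimes>\<^sub>M P)"
  proof (rule measurable_compose[OF borel_measurable_psg_step[OF _ _ _ \<open>X \<subseteq> U\<close> G]])
    show "(\<lambda>z. ?x (fst z) n) \<in> borel_measurable (?Q n \<Otimes>\<^sub>M P)"
      by (intro measurable_compose[OF measurable_fst]) simp
  qed (use X psg_iterate_in[OF X(1) X(3)] in auto)
  then have [measurable]: "(\<lambda>w. \<integral>\<^sup>+\<omega>. V (?S (?x w n) \<omega>) \<partial>P) \<in> borel_measurable (?Q n)"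
    by (intro P.borel_measurable_nn_integral) (simp add: split_beta')
  have "(\<integral>\<^sup>+w. V (?x w (Suc n)) \<partial>?Q (Suc n))
      = (\<integral>\<^sup>+w. \<integral>\<^sup>+\<omega>. V (?x (w(n := \<omega>)) (Suc n)) \<partial>P \<partial>?Q n)"
    unfolding lessThan_Suc
  proof (rule product_nn_integral_insert)
    show "(\<lambda>w. V (?x w (Suc n))) \<in> borel_measurable (\<Pi>\<^sub>M i\<in>insert n {..<n}. P)"
      by (rule measurable_compose[OF x_meas]) (simp_all only: lessThan_Suc subset_refl assms)
  qed auto
  also have "\<dots> = (\<integral>\<^sup>+w. \<integral>\<^sup>+\<omega>. V (?S (?x w n) \<omega>) \<partial>P \<partial>?Q n)"
  proof -
    have "?x (w(n := \<omega>)) n = ?x w n" for w \<omega>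
      by (rule psg_iterate_cong) simp
    then show ?thesis by simp
  qed
  finally have "(\<integral>\<^sup>+w. V (?x w (Suc n)) \<partial>?Q (Suc n)) + b n * (\<integral>\<^sup>+w. D (?x w n) \<partial>?Q n)
      = (\<integral>\<^sup>+w. (\<integral>\<^sup>+\<omega>. V (?S (?x w n) \<omega>) \<partial>P) + b n * D (?x w n) \<partial>?Q n)"
    by (simp add: nn_integral_add nn_integral_cmult)
  also have "\<dots> \<le> (\<integral>\<^sup>+w. V (?x w n) + C n \<partial>?Q n)"
    by (intro nn_integral_mono step psg_iterate_in X)
  also have "\<dots> = (\<integral>\<^sup>+w. V (?x w n) \<partial>?Q n) + C n"
    by (simp add: nn_integral_add Qn.emeasure_space_1)
  finally have step_n: "(\<integral>\<^sup>+w. V (?x w (Suc n)) \<partial>?Q (Suc n)) + b n * (\<integral>\<^sup>+w. D (?x w n) \<partial>?Q n)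
      \<le> (\<integral>\<^sup>+w. V (?x w n) \<partial>?Q n) + C n" .
  have "(\<integral>\<^sup>+w. V (?x w (Suc n)) \<partial>?Q (Suc n))
        + (\<Sum>t<Suc n. b t * (\<integral>\<^sup>+w. D (?x w t) \<partial>?Q t))
      \<le> (\<integral>\<^sup>+w. V (?x w n) \<partial>?Q n) + C n + (\<Sum>t<n. b t * (\<integral>\<^sup>+w. D (?x w t) \<partial>?Q t))"
    using add_right_mono[OF step_n, of "\<Sum>t<n. b t * (\<integral>\<^sup>+w. D (?x w t) \<partial>?Q t)"]
    by (simp only: sum.lessThan_Suc ac_simps)
  also have "\<dots> \<le> V x0 + (\<Sum>t<Suc n. C t)"
    using add_right_mono[OF Suc.IH, of "C n"] by (simp only: sum.lessThan_Suc ac_simps)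
  finally show ?case .
qed

section \<open>Independence and marginals\<close>

text \<open>
  Independence says that restricting \<open>M\<close> to the event \<open>X \<in> A\<close> rescales the law of \<open>Y\<close> by the probability
  of the event; integrating \<open>f\<close> against both descriptions of this law gives the product formula.
\<close>

lemma indep_rv_nn_integral_event:
  assumes M: "prob_space M" and ind: "indep_rv M S X N Y" and A: "A \<in> sets S"
    and f [measurable]: "f \<in> borel_measurable N"
  shows "(\<integral>\<^sup>+m. indicator (X -` A \<inter> space M) m * f (Y m) \<partial>M)
       = emeasure M (X -` A \<inter> space M) * (\<integral>\<^sup>+m. f (Y m) \<partial>M)"
proof -
  interpret prob_space M by (rule M)
  have X: "X \<in> measurable M S" and Y [measurable]: "Y \<in> measurable M N"
    and indep: "indep_set {X -` A \<inter> space M | A. A \<in> sets S} {Y -` B \<inter> space M | B. B \<in> sets N}"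
    using ind by (auto simp: indep_rv_def)
  define W where "W = X -` A \<inter> space M"
  have [measurable]: "W \<in> sets M" unfolding W_def by (rule measurable_sets[OF X A])
  have "distr (density M (indicator W)) N Y = scale_measure (emeasure M W) (distr M N Y)"
  proof (rule measure_eqI)
    fix B assume "B \<in> sets (distr (density M (indicator W)) N Y)"
    then have B: "B \<in> sets N" by simp
    have "emeasure (distr (density M (indicator W)) N Y) B = emeasure M (W \<inter> (Y -` B \<inter> space M))"
      using B by (simp add: emeasure_distr emeasure_density nn_integral_indicator
          measurable_sets[OF Y] flip: indicator_inter_arith)
    also have "\<dots> = ennreal (prob W * prob (Y -` B \<inter> space M))"
      using indep_setD[OF indep, of W "Y -` B \<inter> space M"] A B
      by (auto simp: emeasure_eq_measure W_def)
    also have "\<dots> = emeasure (scale_measure (emeasure M W) (distr M N Y)) B"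
      using B by (simp add: emeasure_distr emeasure_eq_measure ennreal_mult)
    finally show "emeasure (distr (density M (indicator W)) N Y) B
        = emeasure (scale_measure (emeasure M W) (distr M N Y)) B" .
  qed simp
  then have "(\<integral>\<^sup>+y. f y \<partial>distr (density M (indicator W)) N Y)
      = (\<integral>\<^sup>+y. f y \<partial>scale_measure (emeasure M W) (distr M N Y))" by simp
  then show ?thesis
    by (simp add: nn_integral_distr nn_integral_density nn_integral_scale_measure flip: W_def)
qed

lemma nn_integral_PiM_restrict:
  assumes P: "prob_space P" and "finite K" and "J \<subseteq> K"
    and f: "f \<in> borel_measurable (\<Pi>\<^sub>M i\<in>J. P)" and eq: "\<And>w. f (restrict w J) = f w"
  shows "(\<integral>\<^sup>+w. f w \<partial>(\<Pi>\<^sub>M i\<in>J. P)) = (\<integral>\<^sup>+w. f w \<partial>(\<Pi>\<^sub>M i\<in>K. P))"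
proof -
  interpret prob_space P by (rule P)
  interpret product_prob_space "\<lambda>_. P" UNIV by unfold_locales
  have "(\<integral>\<^sup>+w. f w \<partial>(\<Pi>\<^sub>M i\<in>J. P))
      = (\<integral>\<^sup>+w. f w \<partial>distr (\<Pi>\<^sub>M i\<in>K. P) (\<Pi>\<^sub>M i\<in>J. P) (\<lambda>w. restrict w J))"
    using assms by (subst distr_restrict[of J K]) auto
  also have "\<dots> = (\<integral>\<^sup>+w. f (restrict w J) \<partial>(\<Pi>\<^sub>M i\<in>K. P))"
    using assms by (intro nn_integral_distr measurable_restrict_subset) auto
  finally show ?thesis by (simp add: eq)
qed

section \<open>Convergence rate of the stochastic projected subgradient method\<close>

theorem theorem2p1:
  fixes X U :: "(real ^ 'd) set"
    and g :: "real ^ 'd \<Rightarrow> real"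
    and r \<phi> :: "real ^ 'd \<Rightarrow> ereal"
    and P :: "'w measure"
    and G :: "real ^ 'd \<Rightarrow> 'w \<Rightarrow> real ^ 'd"
    and M :: "'m measure"
    and \<xi> :: "nat \<Rightarrow> 'm \<Rightarrow> 'w"
    and tstar :: "'m \<Rightarrow> nat"
    and x0 :: "real ^ 'd"
    and \<alpha> :: "nat \<Rightarrow> real"
    and \<rho> \<rho>hat L :: real
    and T :: nat
  assumes "closed X" and "convex X"
    and r: "r = indicator_fun X"
    and "\<rho> \<ge> 0" and "weakly_convex \<rho> g"
    and phi: "\<phi> = (\<lambda>x. ereal (g x) + r x)"
    and min_exists: "\<exists>x. \<forall>y. \<phi> x \<le> \<phi> y"
    and "prob_space P"
    and "prob_space M"
    and A1_indep: "prob_space.indep_vars M (\<lambda>_. P) \<xi> {..T}"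
    and A1_distr: "\<And>t. t \<le> T \<Longrightarrow> distr M P (\<xi> t) = P"
    and "open U" and "eff_dom r \<subseteq> U"
    and A2_meas: "(\<lambda>(x, \<omega>). G x \<omega>) \<in> borel_measurable (restrict_space borel U \<Otimes>\<^sub>M P)"
    and A2_int: "\<And>x. x \<in> U \<Longrightarrow> integrable P (G x)"
    and A2_subgrad: "\<And>x. x \<in> U \<Longrightarrow> (LINT \<omega>|P. G x \<omega>) \<in> subdifferential g x"
    and "L \<ge> 0"
    and A3_int: "\<And>x. x \<in> eff_dom r \<Longrightarrow> integrable P (\<lambda>\<omega>. (norm (G x \<omega>))\<^sup>2)"
    and A3_bound: "\<And>x. x \<in> eff_dom r \<Longrightarrow> (LINT \<omega>|P. (norm (G x \<omega>))\<^sup>2) \<le> L\<^sup>2"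
    and "x0 \<in> X"
    and alpha_pos: "\<And>t. \<alpha> t > 0"
    and tstar_indep: "indep_rv M (count_space {..T}) tstar
           (\<Pi>\<^sub>M t\<in>{..T}. P) (\<lambda>m. \<lambda>t\<in>{..T}. \<xi> t m)"
    and tstar_distr: "\<And>t. t \<le> T \<Longrightarrow>
           measure M {m \<in> space M. tstar m = t} = \<alpha> t / (\<Sum>s=0..T. \<alpha> s)"
    and "\<rho>hat > \<rho>"
  shows "integrable M (\<lambda>m. (norm (gradient (moreau_envelope (1 / \<rho>hat) \<phi>)
             (psg_iterate X G \<alpha> x0 (\<lambda>t. \<xi> t m) (tstar m))))\<^sup>2) \<and>
         (LINT m|M. (norm (gradient (moreau_envelope (1 / \<rho>hat) \<phi>)
             (psg_iterate X G \<alpha> x0 (\<lambda>t. \<xi> t m) (tstar m))))\<^sup>2)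
         \<le> \<rho>hat / (\<rho>hat - \<rho>) *
             ((moreau_envelope (1 / \<rho>hat) \<phi> x0 - min_value \<phi>
                + \<rho>hat * L\<^sup>2 / 2 * (\<Sum>t=0..T. (\<alpha> t)\<^sup>2)) / (\<Sum>t=0..T. \<alpha> t))"
proof -
  interpret M: prob_space M by fact
  interpret P: prob_space P by fact
  have phi': "\<phi> = (\<lambda>x. ereal (g x) + indicator_fun X x)" by (simp add: phi r)
  obtain z where z: "\<And>y. \<phi> z \<le> \<phi> y" using min_exists by auto
  have "z \<in> X"
    using z[of x0] \<open>x0 \<in> X\<close> by (auto simp: phi' indicator_fun_def split: if_splits)
  then have min_phi: "min_value \<phi> = g z"
    using min_value_eqI[of \<phi> z] z by (simp add: phi' indicator_fun_def)
  \<comment> \<open>The minimum of \<open>\<phi>\<close> is attained at the feasible point \<open>z\<close>, hence is a finite lower bound for \<open>g\<close> on \<open>X\<close>.\<close>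
  interpret constrained_weakly_convex X g \<rho> \<rho>hat "min_value \<phi>"
  proof
    show "min_value \<phi> \<le> g y" if "y \<in> X" for y
      using z[of y] that \<open>z \<in> X\<close> by (simp add: min_phi) (simp add: phi' indicator_fun_def)
  qed (use assms in auto)
  have env: "moreau_envelope (1 / \<rho>hat) \<phi> = envelope"
    unfolding phi' by (rule moreau_envelope_eq)
  have dom: "eff_dom r = X"
    by (auto simp: eff_dom_def r indicator_fun_def)
  then have "X \<subseteq> U" using \<open>eff_dom r \<subseteq> U\<close> by simp
  \<comment> \<open>\<open>d t\<close> is the expected squared gradient at iterate \<open>t\<close>; \<open>B\<close> collects the initial gap and the error terms.\<close>
  define D where "D x = (norm (gradient envelope x))\<^sup>2" for x
  define x where "x w t = psg_iterate X G \<alpha> x0 w t" for w t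
  define \<Xi> where "\<Xi> m = (\<lambda>t\<in>{..T}. \<xi> t m)" for m
  define W where "W t = {m \<in> space M. tstar m = t}" for t
  define A where "A = (\<Sum>t=0..T. \<alpha> t)"
  define \<kappa> where "\<kappa> = (\<rho>hat - \<rho>) / \<rho>hat"
  define B where "B = envelope x0 - min_value \<phi> + \<rho>hat * L\<^sup>2 / 2 * (\<Sum>t=0..T. (\<alpha> t)\<^sup>2)"
  define d where "d t = (\<integral>\<^sup>+m. ennreal (D (x (\<Xi> m) t)) \<partial>M)" for t
  have "A > 0" unfolding A_def by (intro sum_pos alpha_pos) auto
  have "\<kappa> > 0" using \<open>\<rho>hat > \<rho>\<close> s_pos by (simp add: \<kappa>_def)
  have "B \<ge> 0"
    unfolding B_def using envelope_lower_bound[of x0] s_pos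
    by (intro add_nonneg_nonneg mult_nonneg_nonneg sum_nonneg) auto
  have [measurable]: "D \<in> borel_measurable borel"
    unfolding D_def gradient_envelope
    by (intro borel_measurable_continuous_onI continuous_intros continuous_prox)
  have [measurable]: "envelope \<in> borel_measurable borel"
    by (intro borel_measurable_continuous_onI continuous_envelope)
  have x_meas: "(\<lambda>w. x w t) \<in> borel_measurable (\<Pi>\<^sub>M i\<in>I. P)" if "{..<t} \<subseteq> I" for t I
    unfolding x_def
    by (rule borel_measurable_psg_iterate[OF \<open>closed X\<close> \<open>convex X\<close> \<open>x0 \<in> X\<close> \<open>X \<subseteq> U\<close> A2_meas that])

  have \<Xi>_meas [measurable]: "\<Xi> \<in> measurable M (\<Pi>\<^sub>M t\<in>{..T}. P)"
    using tstar_indep by (simp add: indep_rv_def \<Xi>_def[abs_def])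
  \<comment> \<open>The joint law of the samples is the product measure, by independence and identical distribution.\<close>
  have \<Xi>_distr: "distr M (\<Pi>\<^sub>M t\<in>{..T}. P) \<Xi> = (\<Pi>\<^sub>M t\<in>{..T}. P)"
  proof -
    have "distr M (\<Pi>\<^sub>M t\<in>{..T}. P) \<Xi> = (\<Pi>\<^sub>M t\<in>{..T}. distr M P (\<xi> t))"
      unfolding \<Xi>_def[abs_def] using A1_indep
      by (subst M.indep_vars_iff_distr_eq_PiM'[symmetric]) (auto simp: M.indep_vars_def)
    also have "\<dots> = (\<Pi>\<^sub>M t\<in>{..T}. P)"
      by (intro PiM_cong A1_distr) auto
    finally show ?thesis .
  qed

  have "(\<integral>\<^sup>+w. ennreal (envelope (x w (Suc T)) - min_value \<phi>) \<partial>(\<Pi>\<^sub>M i\<in>{..<Suc T}. P))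
      + (\<Sum>t<Suc T. ennreal (\<kappa> * \<alpha> t) * (\<integral>\<^sup>+w. ennreal (D (x w t)) \<partial>(\<Pi>\<^sub>M i\<in>{..<t}. P)))
      \<le> ennreal (envelope x0 - min_value \<phi>) + (\<Sum>t<Suc T. ennreal (\<rho>hat * L\<^sup>2 / 2 * (\<alpha> t)\<^sup>2))"
    unfolding x_def
  proof (rule expected_psg_descent[OF \<open>closed X\<close> \<open>convex X\<close> \<open>x0 \<in> X\<close> \<open>X \<subseteq> U\<close> A2_meas \<open>prob_space P\<close>])
    fix y t assume "y \<in> X"
    then show "(\<integral>\<^sup>+\<omega>. ennreal (envelope (closest_point X (y - \<alpha> t *\<^sub>R G y \<omega>)) - min_value \<phi>) \<partial>P)
        + ennreal (\<kappa> * \<alpha> t) * ennreal (D y)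
        \<le> ennreal (envelope y - min_value \<phi>) + ennreal (\<rho>hat * L\<^sup>2 / 2 * (\<alpha> t)\<^sup>2)"
      unfolding \<kappa>_def D_def using \<open>X \<subseteq> U\<close> dom
      by (intro expected_envelope_step \<open>prob_space P\<close> alpha_pos A2_int A2_subgrad A3_int A3_bound) auto
  qed measurable
  \<comment> \<open>Iterate \<open>t\<close> ignores the later samples, so its expectation may be taken over all of them, that is, over \<open>M\<close>.\<close>
  moreover have "(\<integral>\<^sup>+w. ennreal (D (x w t)) \<partial>(\<Pi>\<^sub>M i\<in>{..<t}. P)) = d t" if "t \<le> T" for t
  proof -
    have "{..<t} \<subseteq> {..T}" using that by auto
    note [measurable] = x_meas[OF this] x_meas[OF subset_refl]
    have "(\<integral>\<^sup>+w. ennreal (D (x w t)) \<partial>(\<Pi>\<^sub>M i\<in>{..<t}. P))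
        = (\<integral>\<^sup>+w. ennreal (D (x w t)) \<partial>(\<Pi>\<^sub>M i\<in>{..T}. P))"
    proof (rule nn_integral_PiM_restrict[OF \<open>prob_space P\<close> _ \<open>{..<t} \<subseteq> {..T}\<close>])
      show "ennreal (D (x (restrict w {..<t}) t)) = ennreal (D (x w t))" for w
        unfolding x_def by (subst psg_iterate_cong[of t "restrict w {..<t}" w]) auto
    qed auto
    also have "\<dots> = d t"
      unfolding d_def by (subst \<Xi>_distr[symmetric]) (rule nn_integral_distr; measurable)
    finally show ?thesis .
  qed
  moreover have "ennreal (envelope x0 - min_value \<phi>) + (\<Sum>t<Suc T. ennreal (\<rho>hat * L\<^sup>2 / 2 * (\<alpha> t)\<^sup>2))
      = ennreal B"
    using envelope_lower_bound[of x0] s_pos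
    by (simp add: B_def sum_ennreal sum_nonneg sum_distrib_left ennreal_plus lessThan_Suc_atMost atLeast0AtMost
        del: sum.lessThan_Suc)
  ultimately have "(\<integral>\<^sup>+w. ennreal (envelope (x w (Suc T)) - min_value \<phi>) \<partial>(\<Pi>\<^sub>M i\<in>{..<Suc T}. P))
      + (\<Sum>t\<le>T. ennreal (\<kappa> * \<alpha> t) * d t) \<le> ennreal B"
    by (simp add: lessThan_Suc_atMost del: sum.lessThan_Suc)
  \<comment> \<open>The telescoped bound keeps the nonnegative gap at the last iterate, which is dropped here.\<close>
  then have weighted: "(\<Sum>t\<le>T. ennreal (\<kappa> * \<alpha> t) * d t) \<le> ennreal B"
    by (rule order_trans[rotated]) simp

  define F where "F m = (norm (gradient (moreau_envelope (1 / \<rho>hat) \<phi>)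
             (psg_iterate X G \<alpha> x0 (\<lambda>t. \<xi> t m) (tstar m))))\<^sup>2" for m
  \<comment> \<open>Splitting by the value of the random index turns the returned point into the deterministic-time iterates.\<close>
  have F_eq: "F m = (\<Sum>t\<le>T. indicator (W t) m * D (x (\<Xi> m) t))" if "m \<in> space M" for m
  proof -
    have "tstar \<in> measurable M (count_space {..T})"
      using tstar_indep by (simp add: indep_rv_def)
    from measurable_space[OF this that] have "tstar m \<le> T" by simp
    have "x (\<Xi> m) (tstar m) = psg_iterate X G \<alpha> x0 (\<lambda>t. \<xi> t m) (tstar m)"
      unfolding x_def using \<open>tstar m \<le> T\<close> by (intro psg_iterate_cong) (auto simp: \<Xi>_def)
    moreover have "(\<Sum>t\<le>T. indicator (W t) m * D (x (\<Xi> m) t))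
        = (\<Sum>t\<le>T. if t = tstar m then D (x (\<Xi> m) t) else 0)"
      using that by (intro sum.cong) (auto simp: W_def)
    ultimately show ?thesis
      using \<open>tstar m \<le> T\<close> by (simp add: F_def env D_def)
  qed
  have W_eq: "W t = tstar -` {t} \<inter> space M" for t by (auto simp: W_def)
  have W_meas [measurable]: "W t \<in> sets M" if "t \<le> T" for t
    using tstar_indep that unfolding W_eq indep_rv_def by (intro measurable_sets[of tstar M "count_space {..T}"]) auto
  have Dx_meas: "(\<lambda>w. D (x w t)) \<in> borel_measurable (\<Pi>\<^sub>M i\<in>{..T}. P)" if "t \<le> T" for t
    using that by (intro measurable_compose[OF x_meas]) auto
  have Dx\<Xi>_meas: "(\<lambda>m. D (x (\<Xi> m) t)) \<in> borel_measurable M" if "t \<le> T" for t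
    by (rule measurable_compose[OF \<Xi>_meas Dx_meas[OF that]])
  have "(\<lambda>m. \<Sum>t\<le>T. indicator (W t) m * D (x (\<Xi> m) t)) \<in> borel_measurable M"
    using W_meas Dx\<Xi>_meas by (intro borel_measurable_sum borel_measurable_times borel_measurable_indicator) auto
  then have F_meas: "F \<in> borel_measurable M"
    using F_eq by (subst measurable_cong) auto
  have "(\<integral>\<^sup>+m. ennreal (F m) \<partial>M) = (\<integral>\<^sup>+m. (\<Sum>t\<le>T. indicator (W t) m * ennreal (D (x (\<Xi> m) t))) \<partial>M)"
  proof (intro nn_integral_cong)
    fix m assume "m \<in> space M"
    have "ennreal (F m) = (\<Sum>t\<le>T. ennreal (indicator (W t) m * D (x (\<Xi> m) t)))"
      unfolding F_eq[OF \<open>m \<in> space M\<close>] by (intro sum_ennreal[symmetric]) (simp add: D_def)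
    also have "\<dots> = (\<Sum>t\<le>T. indicator (W t) m * ennreal (D (x (\<Xi> m) t)))"
      by (intro sum.cong) (auto split: split_indicator)
    finally show "ennreal (F m) = (\<Sum>t\<le>T. indicator (W t) m * ennreal (D (x (\<Xi> m) t)))" .
  qed
  also have "\<dots> = (\<Sum>t\<le>T. \<integral>\<^sup>+m. indicator (W t) m * ennreal (D (x (\<Xi> m) t)) \<partial>M)"
    using W_meas Dx\<Xi>_meas by (intro nn_integral_sum borel_measurable_times_ennreal borel_measurable_indicator) auto
  \<comment> \<open>The index is independent of the samples, hence each event \<open>W t\<close> contributes its probability as a factor.\<close>
  also have "\<dots> = (\<Sum>t\<le>T. ennreal (\<alpha> t / A) * d t)"
  proof (intro sum.cong refl)
    fix t assume "t \<in> {..T}"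
    then have "t \<le> T" by simp
    have "(\<integral>\<^sup>+m. indicator (W t) m * ennreal (D (x (\<Xi> m) t)) \<partial>M) = emeasure M (W t) * d t"
      unfolding W_eq d_def
      using indep_rv_nn_integral_event[OF \<open>prob_space M\<close> tstar_indep, of "{t}" "\<lambda>w. ennreal (D (x w t))"]
        \<open>t \<le> T\<close> Dx_meas[OF \<open>t \<le> T\<close>] by (simp add: \<Xi>_def)
    also have "emeasure M (W t) = ennreal (\<alpha> t / A)"
      using tstar_distr[OF \<open>t \<le> T\<close>] by (simp add: M.emeasure_eq_measure W_def A_def)
    finally show "(\<integral>\<^sup>+m. indicator (W t) m * ennreal (D (x (\<Xi> m) t)) \<partial>M) = ennreal (\<alpha> t / A) * d t" .
  qed
  also have "\<dots> = (\<Sum>t\<le>T. ennreal (1 / (\<kappa> * A)) * (ennreal (\<kappa> * \<alpha> t) * d t))"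
  proof (intro sum.cong refl)
    fix t
    have "ennreal (\<alpha> t / A) = ennreal (1 / (\<kappa> * A)) * ennreal (\<kappa> * \<alpha> t)"
      using \<open>\<kappa> > 0\<close> \<open>A > 0\<close> alpha_pos[of t] by (subst ennreal_mult[symmetric]) auto
    then show "ennreal (\<alpha> t / A) * d t = ennreal (1 / (\<kappa> * A)) * (ennreal (\<kappa> * \<alpha> t) * d t)"
      by (simp add: mult.assoc)
  qed
  also have "\<dots> = ennreal (1 / (\<kappa> * A)) * (\<Sum>t\<le>T. ennreal (\<kappa> * \<alpha> t) * d t)"
    by (rule sum_distrib_left[symmetric])
  also have "\<dots> \<le> ennreal (1 / (\<kappa> * A)) * ennreal B"
    by (intro mult_left_mono weighted) simp
  also have "\<dots> = ennreal (1 / (\<kappa> * A) * B)"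
    using \<open>\<kappa> > 0\<close> \<open>A > 0\<close> \<open>B \<ge> 0\<close> by (subst ennreal_mult) auto
  finally have bound: "(\<integral>\<^sup>+m. ennreal (F m) \<partial>M) \<le> ennreal (1 / (\<kappa> * A) * B)" .
  have "F m \<ge> 0" for m by (simp add: F_def)
  have F_int: "integrable M F"
    using F_meas bound \<open>\<And>m. F m \<ge> 0\<close> by (intro integrableI_nonneg) (auto intro: le_less_trans)
  then have "ennreal (LINT m|M. F m) \<le> ennreal (1 / (\<kappa> * A) * B)"
    using bound nn_integral_eq_integral[OF F_int] \<open>\<And>m. F m \<ge> 0\<close> by simp
  then have "(LINT m|M. F m) \<le> 1 / (\<kappa> * A) * B"
    using \<open>\<kappa> > 0\<close> \<open>A > 0\<close> \<open>B \<ge> 0\<close> by (subst (asm) ennreal_le_iff) auto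
  also have "\<dots> = \<rho>hat / (\<rho>hat - \<rho>) * (B / A)"
    by (simp add: \<kappa>_def)
  finally show ?thesis
    using F_int by (simp add: F_def[abs_def] B_def A_def env)
qed

end
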